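(* Let $F$ be a distribution on $\mathbb R$. Let $c>0$ and $\Delta=(0,c]$. If $F\in\mathcal D_\Delta$, then $$F^+\in\mathcal S_\Delta\iff F_+\in\mathcal S_\Delta\iff F\in\mathcal S_\Delta.$$ Consequently, if $F\in\mathcal D_{loc}$, then $$F^+\in\mathcal S_{loc}\iff F_+\in\mathcal S_{loc}\iff F\in\mathcal S_{loc}.$$
   Context: $F_+$ is the conditional distribution of $F$ on $\mathbb R_+=[0,\infty)$, i.e. $F_+(B)=F(B\cap[0,\infty))/F([0,\infty))$ (an assertion that $F_+$ belongs to a class includes $F([0,\infty))>0$). $F^+$ is the distribution with distribution function $F^+(x)=F(x)$ for $x\ge0$ and $F^+(x)=0$ for $x<0$. For $\Delta=(0,c]$, $F(x+\Delta):=F((x,x+c])$. $F^{*n}$ is the $n$-fold convolution. $\alpha(x)\sim\beta(x)$ means $\alpha(x)/\beta(x)\to1$ as $x\to\infty$. A non-negative measurable function $\alpha$ belongs to $\mathcal L$ if there is $x_0>0$ with $\alpha(x)>0$ for $x\ge x_0$ and, for every fixed $y>0$, $\alpha(x+y)\sim\alpha(x)$. $F\in\mathcal L_\Delta$ if $x\mapsto F(x+\Delta)$ is in $\mathcal L$; $F\in\mathcal S_\Delta$ if $F\in\mathcal L_\Delta$ and $F^{*2}(x+\Delta)\sim 2F(x+\Delta)$. A function $\alpha:\mathbb R\to\mathbb R_+$ is almost decreasing if there exist $x_0>0$ and $K>0$ such that $\alpha(x+y)\le K\alpha(x)$ for all $x>x_0$, $y>0$. $F\in\mathcal D_\Delta$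 if $x\mapsto F(x+\Delta)$ is almost decreasing. $F\in\mathcal S_{loc}$ (resp. $\mathcal D_{loc}$) if $F\in\mathcal S_\Delta$ (resp. $\mathcal D_\Delta$) for all $\Delta=(0,c]$ with $c>0$. *)

theory Defs
  imports "HOL-Probability.Probability" "HOL-Library.Landau_Symbols"
begin

text \<open>
  A distribution on the real line is a probability measure on the Borel sets
  (library locale \<^locale>\<open>real_distribution\<close>).  The interval \<open>\<Delta> = (0, c]\<close> is represented by its
  length \<open>c\<close>, so \<open>F(x + \<Delta>) = F((x, x + c])\<close>.
\<close>

definition delta_mass :: "real \<Rightarrow> real measure \<Rightarrow> real \<Rightarrow> real" where
  "delta_mass c F x = measure F {x<..x + c}"

text \<open>
  The library relation \<open>f \<sim>[at_top] g\<close> is convergence of \<open>f x / g x\<close> to 1, with \<open>0 / 0\<close> read as 1.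
  That convention is never used in the definitions below, because in each of them the function
  on the right is required to be positive from some point on.
\<close>

definition long_tailed_fun :: "(real \<Rightarrow> real) \<Rightarrow> bool" where
  "long_tailed_fun \<alpha> \<longleftrightarrow>
     (\<forall>x. 0 \<le> \<alpha> x) \<and> \<alpha> \<in> borel_measurable borel \<and>
     (\<exists>x\<^sub>0>0. \<forall>x\<ge>x\<^sub>0. 0 < \<alpha> x) \<and>
     (\<forall>y>0. (\<lambda>x. \<alpha> (x + y)) \<sim>[at_top] \<alpha>)"

definition almost_decreasing :: "(real \<Rightarrow> real) \<Rightarrow> bool" where
  "almost_decreasing \<alpha> \<longleftrightarrow>
     (\<forall>x. 0 \<le> \<alpha> x) \<and>
     (\<exists>x\<^sub>0>0. \<exists>K>0. \<forall>x>x\<^sub>0. \<forall>y>0. \<alpha> (x + y) \<le> K * \<alpha> x)"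

definition L_Delta :: "real \<Rightarrow> real measure set" where
  "L_Delta c = {F. real_distribution F \<and> long_tailed_fun (delta_mass c F)}"

definition S_Delta :: "real \<Rightarrow> real measure set" where
  "S_Delta c = {F. F \<in> L_Delta c \<and>
     delta_mass c (F \<star> F) \<sim>[at_top] (\<lambda>x. 2 * delta_mass c F x)}"

definition D_Delta :: "real \<Rightarrow> real measure set" where
  "D_Delta c = {F. real_distribution F \<and> almost_decreasing (delta_mass c F)}"

definition S_loc :: "real measure set" where
  "S_loc = {F. \<forall>c>0. F \<in> S_Delta c}"

definition D_loc :: "real measure set" where
  "D_loc = {F. \<forall>c>0. F \<in> D_Delta c}"

text \<open>
  \<open>F\<^sub>+\<close>, the conditional distribution of \<open>F\<close> on \<open>[0, \<infinity>)\<close>.  It is meaningful only if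
  \<open>F([0, \<infinity>)) > 0\<close>; assertions about it have to include this condition.
\<close>

definition cond_nonneg :: "real measure \<Rightarrow> real measure" where
  "cond_nonneg F = uniform_measure F {0..}"

text \<open>
  \<open>F\<^sup>+\<close>: \<^const>\<open>interval_measure\<close> turns a distribution function into the corresponding measure;
  the lemmas below confirm that its argument here is a distribution function.
\<close>

definition pos_part_distr :: "real measure \<Rightarrow> real measure" where
  "pos_part_distr F = interval_measure (\<lambda>x. if 0 \<le> x then cdf F x else 0)"

lemma
  assumes "real_distribution F"
  shows real_distribution_pos_part_distr: "real_distribution (pos_part_distr F)"
    and cdf_pos_part_distr: "cdf (pos_part_distr F) = (\<lambda>x. if 0 \<le> x then cdf F x else 0)"
proof -
  interpret real_distribution F by fact
  let ?G = "\<lambda>x. if 0 \<le> x then cdf F x else 0"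
  have mono: "?G x \<le> ?G y" if "x \<le> y" for x y
    using that by (auto simp: cdf_nonneg intro: cdf_nondecreasing)
  have cont: "continuous (at_right a) ?G" for a
  proof (cases "0 \<le> a")
    case True
    have "\<forall>\<^sub>F x in at_right a. cdf F x = ?G x"
      using True by (auto simp: eventually_at_filter intro!: always_eventually)
    then show ?thesis
      using cdf_is_right_cont[of a] True
      by (auto simp: continuous_within intro: Lim_transform_eventually)
  next
    case False
    then have "\<forall>\<^sub>F x in at_right a. 0 = ?G x"
      using eventually_at_right[of a 0] by (auto intro!: exI[of _ 0])
    then show ?thesis
      using False by (auto simp: continuous_within intro: Lim_transform_eventually)
  qed
  have bot: "(?G \<longlongrightarrow> 0) at_bot"
    by (rule tendsto_eventually) (auto simp: eventually_at_bot_linorder intro!: exI[of _ "-1"])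
  have top: "(?G \<longlongrightarrow> 1) at_top"
    by (rule Lim_transform_eventually[OF cdf_lim_at_top_prob])
       (auto simp: eventually_at_top_linorder intro!: exI[of _ 0])
  show "real_distribution (pos_part_distr F)"
    unfolding pos_part_distr_def
    by (rule real_distribution_interval_measure[OF mono cont bot top])
  show "cdf (pos_part_distr F) = ?G"
    unfolding pos_part_distr_def
    by (rule cdf_interval_measure[OF mono cont bot])
qed

end

theory Submission
  imports Defs
begin

text \<open>
  Membership in \<open>\<S>\<^sub>\<Delta>\<close> of a distribution in \<open>\<D>\<^sub>\<Delta>\<close> depends only on its restriction to
  \<open>(0, \<infinity>)\<close>, up to a constant factor.  Let \<open>X, Y\<close> be independent with law \<open>F\<close>.  For \<open>x \<ge> 0\<close> the
  event \<open>X + Y \<in> (x, x + c]\<close> excludes that both summands are \<open>\<le> 0\<close>, hence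
  \[ F^{*2}(x+\Delta) = 2 \int_{(-\infty,0]} F(x-u+\Delta)\,F(du) + I_F(x), \]
  where \<open>I\<^sub>F(x)\<close> is the contribution of \<open>X, Y > 0\<close>.  On the range of integration the shift
  \<open>-u\<close> is nonnegative; almost monotonicity therefore bounds \<open>F(x-u+\<Delta>) / F(x+\<Delta>)\<close> uniformly in
  \<open>u\<close>, the long tail gives its limit 1, and by dominated convergence the integral divided by
  \<open>F(x+\<Delta>)\<close> tends to \<open>F((-\<infinity>,0])\<close> (lemma \<open>tendsto_nonpos_contribution\<close>).  So, given
  \<open>F \<in> \<L>\<^sub>\<Delta> \<inter> \<D>\<^sub>\<Delta>\<close>, membership in \<open>\<S>\<^sub>\<Delta>\<close> is equivalent to \<open>I\<^sub>F(x) / F(x+\<Delta>) \<rightarrow> 2 F((0,\<infinity>))\<close> (lemma \<open>S_Delta_iff_pos_contribution\<close>).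

  If \<open>G = r F\<close> on \<open>(0, \<infinity>)\<close> with \<open>r > 0\<close>, then \<open>I\<^sub>G = r\<^sup>2 I\<^sub>F\<close>, while both \<open>G(x+\<Delta>)\<close> for
  \<open>x \<ge> 0\<close> and \<open>G((0,\<infinity>))\<close> carry a single factor \<open>r\<close>: the criterion is the same for \<open>F\<close> and
  \<open>G\<close> (lemma \<open>S_Delta_iff_of_proportional\<close>).  The theorem consists of the cases \<open>r = 1\<close> for \<open>F\<^sup>+\<close>
  and \<open>r = 1 / F([0,\<infinity>))\<close> for \<open>F\<^sub>+\<close>.  The required positivity of \<open>F([0,\<infinity>))\<close> follows
  from that of \<open>F(x+\<Delta>)\<close> for large \<open>x\<close>.
\<close>

lemma delta_mass_nonneg [simp]: "0 \<le> delta_mass c F x"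
  by (simp add: delta_mass_def)

lemma borel_measurable_delta_mass [measurable]:
  assumes "real_distribution F" "0 < c"
  shows "delta_mass c F \<in> borel_measurable borel"
proof -
  interpret real_distribution F by fact
  have [measurable]: "cdf F \<in> borel_measurable borel"
    by (rule borel_measurable_mono) (auto intro: monoI cdf_nondecreasing)
  have "delta_mass c F = (\<lambda>x. cdf F (x + c) - cdf F x)"
    using assms(2) by (auto simp: delta_mass_def cdf_diff_eq)
  then show ?thesis by simp
qed

lemma asymp_equiv_twice_iff:
  fixes f g :: "real \<Rightarrow> real"
  assumes "\<forall>\<^sub>F x in at_top. 0 < g x"
  shows "f \<sim>[at_top] (\<lambda>x. 2 * g x) \<longleftrightarrow> ((\<lambda>x. f x / g x) \<longlongrightarrow> 2) at_top"
proof -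
  have "f \<sim>[at_top] (\<lambda>x. 2 * g x) \<longleftrightarrow> ((\<lambda>x. f x / (2 * g x)) \<longlongrightarrow> 1) at_top"
    unfolding asymp_equiv_def
    by (rule tendsto_cong) (use assms in eventually_elim, auto)
  also have "\<dots> \<longleftrightarrow> ((\<lambda>x. f x / g x) \<longlongrightarrow> 2) at_top"
  proof
    assume "((\<lambda>x. f x / (2 * g x)) \<longlongrightarrow> 1) at_top"
    from tendsto_mult_left[OF this, of 2] show "((\<lambda>x. f x / g x) \<longlongrightarrow> 2) at_top" by simp
  next
    assume "((\<lambda>x. f x / g x) \<longlongrightarrow> 2) at_top"
    from tendsto_mult_left[OF this, of "1/2"] show "((\<lambda>x. f x / (2 * g x)) \<longlongrightarrow> 1) at_top"
      by simp
  qed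
  finally show ?thesis .
qed

section \<open>Splitting the convolution square\<close>

definition nonpos_contribution :: "real \<Rightarrow> real measure \<Rightarrow> real \<Rightarrow> real" where
  "nonpos_contribution c F x =
     measure (F \<Otimes>\<^sub>M F) {(u, v). u \<le> 0 \<and> x < u + v \<and> u + v \<le> x + c}"

definition pos_contribution :: "real \<Rightarrow> real measure \<Rightarrow> real \<Rightarrow> real" where
  "pos_contribution c F x =
     measure (F \<Otimes>\<^sub>M F) {(u, v). 0 < u \<and> 0 < v \<and> x < u + v \<and> u + v \<le> x + c}"

lemma delta_mass_convolution:
  assumes "real_distribution F" "0 \<le> x"
  shows "delta_mass c (F \<star> F) x = 2 * nonpos_contribution c F x + pos_contribution c F x"
proof -
  interpret real_distribution F by fact
  interpret P: pair_prob_space F F ..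
  let ?P = "F \<Otimes>\<^sub>M F"
  let ?A = "{(u, v). u \<le> 0 \<and> x < u + v \<and> u + v \<le> x + c}"
  let ?B = "{(u, v). v \<le> 0 \<and> x < u + v \<and> u + v \<le> x + c}"
  let ?C = "{(u, v). 0 < u \<and> 0 < v \<and> x < u + v \<and> u + v \<le> x + c}"
  have sp: "space ?P = UNIV" by (simp add: space_pair_measure space_eq_univ)
  have "{p \<in> space ?P. fst p \<le> 0 \<and> x < fst p + snd p \<and> fst p + snd p \<le> x + c} \<in> sets ?P"
    "{p \<in> space ?P. snd p \<le> 0 \<and> x < fst p + snd p \<and> fst p + snd p \<le> x + c} \<in> sets ?P"
    "{p \<in> space ?P. 0 < fst p \<and> 0 < snd p \<and> x < fst p + snd p \<and> fst p + snd p \<le> x + c} \<in> sets ?P"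
    by measurable
  then have A: "?A \<in> sets ?P" and B: "?B \<in> sets ?P" and C: "?C \<in> sets ?P"
    by (simp_all add: sp split_beta')
  have "delta_mass c (F \<star> F) x = measure ?P ((\<lambda>(u, v). u + v) -` {x<..x + c} \<inter> space ?P)"
    unfolding delta_mass_def convolution_def by (intro measure_distr) measurable
  also have "(\<lambda>(u, v). u + v) -` {x<..x + c} \<inter> space ?P = (?A \<union> ?B) \<union> ?C"
    by (auto simp: sp)
  also have "measure ?P \<dots> = measure ?P (?A \<union> ?B) + measure ?P ?C"
    using A B C by (intro P.finite_measure_Union) auto
  also have "measure ?P (?A \<union> ?B) = measure ?P ?A + measure ?P ?B"
    using A B \<open>0 \<le> x\<close> by (intro P.finite_measure_Union) auto
  also have "measure ?P ?B = measure (distr ?P ?P (\<lambda>(u, v). (v, u))) ?B"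
    using P.distr_pair_swap by simp
  also have "\<dots> = measure ?P ((\<lambda>(u, v). (v, u)) -` ?B \<inter> space ?P)"
    by (intro measure_distr B) measurable
  also have "(\<lambda>(u, v). (v, u)) -` ?B \<inter> space ?P = ?A"
    by (auto simp: sp add.commute)
  finally show ?thesis
    by (simp add: nonpos_contribution_def pos_contribution_def)
qed

lemma nonpos_contribution_eq_integral:
  assumes "real_distribution F" "0 < c"
  shows "nonpos_contribution c F x = (\<integral>u. indicator {..0} u * delta_mass c F (x - u) \<partial>F)"
proof -
  interpret real_distribution F by fact
  interpret P: pair_prob_space F F ..
  note [measurable] = borel_measurable_delta_mass[OF assms]
  let ?A = "{(u, v). u \<le> 0 \<and> x < u + v \<and> u + v \<le> x + c}"
  have sp: "space (F \<Otimes>\<^sub>M F) = UNIV" by (simp add: space_pair_measure space_eq_univ)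
  have "{p \<in> space (F \<Otimes>\<^sub>M F). fst p \<le> 0 \<and> x < fst p + snd p \<and> fst p + snd p \<le> x + c}
      \<in> sets (F \<Otimes>\<^sub>M F)"
    by measurable
  then have A: "?A \<in> sets (F \<Otimes>\<^sub>M F)"
    by (simp add: sp split_beta')
  have slice: "Pair u -` ?A = (if u \<le> 0 then {x - u<..x - u + c} else {})" for u
    by auto
  have bound: "norm (indicator {..0} u * delta_mass c F (x - u)) \<le> 1" for u
    by (simp add: indicator_def delta_mass_def)
  have int: "integrable F (\<lambda>u. indicator {..0} u * delta_mass c F (x - u))"
    by (intro integrable_const_bound[where B=1] AE_I2 bound) measurable
  have "ennreal (nonpos_contribution c F x) = (\<integral>\<^sup>+u. emeasure F (Pair u -` ?A) \<partial>F)"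
    unfolding nonpos_contribution_def P.emeasure_eq_measure[symmetric]
    by (rule emeasure_pair_measure_alt[OF A])
  also have "\<dots> = (\<integral>\<^sup>+u. ennreal (indicator {..0} u * delta_mass c F (x - u)) \<partial>F)"
    unfolding slice by (intro nn_integral_cong) (simp add: emeasure_eq_measure delta_mass_def)
  also have "\<dots> = ennreal (\<integral>u. indicator {..0} u * delta_mass c F (x - u) \<partial>F)"
    by (intro nn_integral_eq_integral int) simp
  finally show ?thesis
    by (simp add: nonpos_contribution_def integral_nonneg_AE)
qed

text \<open>
  For \<open>u \<le> 0\<close> the point \<open>x - u\<close> lies to the right of \<open>x\<close>, so the constant of almost
  monotonicity dominates \<open>F(x-u+\<Delta>) / F(x+\<Delta>)\<close> uniformly in \<open>u\<close>.
\<close>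

lemma tendsto_nonpos_contribution:
  assumes "0 < c" "F \<in> L_Delta c" "F \<in> D_Delta c"
  shows "((\<lambda>x. nonpos_contribution c F x / delta_mass c F x) \<longlongrightarrow> measure F {..0}) at_top"
proof -
  let ?D = "delta_mass c F"
  have F: "real_distribution F" using assms by (simp add: L_Delta_def)
  interpret real_distribution F by fact
  note [measurable] = borel_measurable_delta_mass[OF F assms(1)]
  from assms(2) have pos: "\<forall>\<^sub>F x in at_top. 0 < ?D x"
    by (auto simp: L_Delta_def long_tailed_fun_def eventually_at_top_linorder)
  from assms(3) obtain x0 K where K: "K > 0" "\<And>x y. x > x0 \<Longrightarrow> y > 0 \<Longrightarrow> ?D (x + y) \<le> K * ?D x"
    by (auto simp: D_Delta_def almost_decreasing_def)
  have ratio: "((\<lambda>x. ?D (x - u) / ?D x) \<longlongrightarrow> 1) at_top" if "u \<le> 0" for u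
  proof (cases "u = 0")
    case True
    have "\<forall>\<^sub>F x in at_top. 1 = ?D (x - u) / ?D x"
      using pos by eventually_elim (simp add: True)
    then show ?thesis by (rule Lim_transform_eventually[OF tendsto_const])
  next
    case False
    with that have "0 < - u" by simp
    with assms(2) have "(\<lambda>x. ?D (x + - u)) \<sim>[at_top] ?D"
      unfolding L_Delta_def long_tailed_fun_def mem_Collect_eq by blast
    then have "((\<lambda>x. if ?D (x - u) = 0 \<and> ?D x = 0 then 1 else ?D (x - u) / ?D x) \<longlongrightarrow> 1) at_top"
      by (simp add: asymp_equiv_def)
    then show ?thesis
      by (rule Lim_transform_eventually) (use pos in eventually_elim, auto)
  qed
  have "((\<lambda>x. \<integral>u. indicator {..0} u * (?D (x - u) / ?D x) \<partial>F) \<longlongrightarrow>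
          (\<integral>u. indicator {..0} u \<partial>F)) at_top"
  proof (rule integral_dominated_convergence_at_top[where w="\<lambda>_. max 1 K"])
    show "AE u in F. ((\<lambda>x. indicator {..0} u * (?D (x - u) / ?D x)) \<longlongrightarrow> indicator {..0} u) at_top"
      using ratio by (intro AE_I2) (auto simp: indicator_def)
    show "\<forall>\<^sub>F x in at_top. AE u in F. norm (indicator {..0} u * (?D (x - u) / ?D x)) \<le> max 1 K"
      using pos eventually_gt_at_top[of x0]
    proof eventually_elim
      case (elim x)
      have "?D (x - u) \<le> max 1 K * ?D x" if "u \<le> 0" for u
      proof (cases "u = 0")
        case True
        then show ?thesis using mult_right_mono[of 1 "max 1 K" "?D x"] by simp
      next
        case False
        then have "?D (x - u) \<le> K * ?D x" using K(2)[of x "- u"] elim that by simp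
        also have "\<dots> \<le> max 1 K * ?D x" by (intro mult_right_mono) auto
        finally show ?thesis .
      qed
      then show ?case
        using elim by (intro AE_I2) (auto simp: indicator_def divide_le_eq)
    qed
  qed auto
  then show ?thesis
    by (simp add: nonpos_contribution_eq_integral[OF F assms(1)])
qed

text \<open>
  By the previous limit the nonpositive part takes the share \<open>2 F((-\<infinity>,0])\<close> of the limit 2 that
  defines \<open>\<S>\<^sub>\<Delta>\<close>, and \<open>2 F((0,\<infinity>))\<close> is left for the positive part.
\<close>

lemma S_Delta_iff_pos_contribution:
  assumes "0 < c" "F \<in> L_Delta c" "F \<in> D_Delta c"
  shows "F \<in> S_Delta c \<longleftrightarrow>
    ((\<lambda>x. pos_contribution c F x / delta_mass c F x) \<longlongrightarrow> 2 * measure F {0<..}) at_top"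
proof -
  let ?D = "delta_mass c F"
  let ?N = "\<lambda>x. nonpos_contribution c F x / ?D x"
  let ?I = "\<lambda>x. pos_contribution c F x / ?D x"
  let ?Q = "\<lambda>x. delta_mass c (F \<star> F) x / ?D x"
  have F: "real_distribution F" using assms by (simp add: L_Delta_def)
  interpret real_distribution F by fact
  from assms(2) have pos: "\<forall>\<^sub>F x in at_top. 0 < ?D x"
    by (auto simp: L_Delta_def long_tailed_fun_def eventually_at_top_linorder)
  have split: "\<forall>\<^sub>F x in at_top. ?Q x = 2 * ?N x + ?I x"
    using eventually_ge_at_top[of 0]
    by eventually_elim (simp add: delta_mass_convolution[OF F] add_divide_distrib)
  have N: "((\<lambda>x. 2 * ?N x) \<longlongrightarrow> 2 * measure F {..0}) at_top"
    by (intro tendsto_intros tendsto_nonpos_contribution assms)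
  have "UNIV - {..0} = {0::real<..}" by auto
  then have total: "2 - 2 * measure F {..0} = 2 * measure F {0<..}"
    using prob_compl[of "{..0}"] by simp
  have "F \<in> S_Delta c \<longleftrightarrow> (?Q \<longlongrightarrow> 2) at_top"
    using assms(2) asymp_equiv_twice_iff[OF pos] by (simp add: S_Delta_def)
  also have "\<dots> \<longleftrightarrow> (?I \<longlongrightarrow> 2 * measure F {0<..}) at_top"
  proof
    assume "(?Q \<longlongrightarrow> 2) at_top"
    then have "((\<lambda>x. ?Q x - 2 * ?N x) \<longlongrightarrow> 2 * measure F {0<..}) at_top"
      unfolding total[symmetric] by (intro tendsto_diff N)
    then show "(?I \<longlongrightarrow> 2 * measure F {0<..}) at_top"
      by (rule Lim_transform_eventually) (use split in eventually_elim, simp)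
  next
    assume "(?I \<longlongrightarrow> 2 * measure F {0<..}) at_top"
    from tendsto_add[OF N this] have "((\<lambda>x. 2 * ?N x + ?I x) \<longlongrightarrow> 2) at_top"
      unfolding total[symmetric] by simp
    then show "(?Q \<longlongrightarrow> 2) at_top"
      by (rule Lim_transform_eventually) (use split in eventually_elim, simp)
  qed
  finally show ?thesis .
qed

section \<open>Distributions proportional on the positive half-line\<close>

text \<open>
  Passing through \<open>G \<Otimes> F\<close> replaces one factor at a time, so that each step changes only the measures
  of slices, and these lie in \<open>(0, \<infinity>)\<close>.
\<close>

lemma measure_pair_proportional:
  assumes F: "real_distribution F" and G: "real_distribution G" and r: "0 \<le> r"
    and GF: "\<And>B. B \<in> sets borel \<Longrightarrow> B \<subseteq> {0<..} \<Longrightarrow> measure G B = r * measure F B"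
    and S: "S \<in> sets (borel \<Otimes>\<^sub>M borel)" "S \<subseteq> {0<..} \<times> {0<..}"
  shows "measure (G \<Otimes>\<^sub>M G) S = r\<^sup>2 * measure (F \<Otimes>\<^sub>M F) S"
proof -
  interpret F: real_distribution F by fact
  interpret G: real_distribution G by fact
  interpret FF: pair_prob_space F F ..
  interpret GF: pair_prob_space G F ..
  interpret GG: pair_prob_space G G ..
  have SFF: "S \<in> sets (F \<Otimes>\<^sub>M F)" and SGF: "S \<in> sets (G \<Otimes>\<^sub>M F)" and SGG: "S \<in> sets (G \<Otimes>\<^sub>M G)"
    using S(1) sets_pair_measure_cong[of F borel F borel] sets_pair_measure_cong[of G borel F borel]
      sets_pair_measure_cong[of G borel G borel] by simp_all
  have e: "emeasure G B = ennreal r * emeasure F B" if "B \<in> sets borel" "B \<subseteq> {0<..}" for B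
    using GF[OF that] r by (simp add: F.emeasure_eq_measure G.emeasure_eq_measure ennreal_mult)
  have "emeasure (G \<Otimes>\<^sub>M G) S = (\<integral>\<^sup>+u. ennreal r * emeasure F (Pair u -` S) \<partial>G)"
    unfolding G.emeasure_pair_measure_alt[OF SGG]
    by (intro nn_integral_cong e) (use S sets_Pair1[OF S(1)] in auto)
  also have "\<dots> = ennreal r * emeasure (G \<Otimes>\<^sub>M F) S"
    by (simp add: F.emeasure_pair_measure_alt[OF SGF] nn_integral_cmult
        GF.measurable_emeasure_Pair1[OF SGF])
  also have "emeasure (G \<Otimes>\<^sub>M F) S = (\<integral>\<^sup>+v. ennreal r * emeasure F ((\<lambda>u. (u, v)) -` S) \<partial>F)"
    unfolding GF.emeasure_pair_measure_alt2[OF SGF]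
    by (intro nn_integral_cong e) (use S sets_Pair2[OF S(1)] in auto)
  also have "\<dots> = ennreal r * emeasure (F \<Otimes>\<^sub>M F) S"
    by (simp add: FF.emeasure_pair_measure_alt2[OF SFF] nn_integral_cmult
        FF.measurable_emeasure_Pair2[OF SFF])
  finally have "ennreal (measure (G \<Otimes>\<^sub>M G) S) = ennreal (r * (r * measure (F \<Otimes>\<^sub>M F) S))"
    using r by (simp add: FF.emeasure_eq_measure GG.emeasure_eq_measure ennreal_mult)
  then show ?thesis
    using r by (simp add: power2_eq_square)
qed

context
  fixes F G :: "real measure" and r c :: real
  assumes F: "real_distribution F" and G: "real_distribution G" and r: "0 < r" and c: "0 < c"
    and GF: "\<And>B. B \<in> sets borel \<Longrightarrow> B \<subseteq> {0<..} \<Longrightarrow> measure G B = r * measure F B"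
begin

lemma delta_mass_proportional: "0 \<le> x \<Longrightarrow> delta_mass c G x = r * delta_mass c F x"
  unfolding delta_mass_def by (intro GF) auto

lemma pos_contribution_proportional: "pos_contribution c G x = r\<^sup>2 * pos_contribution c F x"
proof -
  have "{p \<in> space (borel \<Otimes>\<^sub>M borel).
      0 < fst p \<and> 0 < snd p \<and> x < fst p + snd p \<and> fst p + snd p \<le> x + c} \<in> sets (borel \<Otimes>\<^sub>M borel)"
    by measurable
  then have "{(u, v). 0 < u \<and> 0 < v \<and> x < u + v \<and> u + v \<le> x + c} \<in> sets (borel \<Otimes>\<^sub>M borel)"
    by (simp add: space_pair_measure split_beta')
  then show ?thesis
    unfolding pos_contribution_def using r
    by (intro measure_pair_proportional[OF F G _ GF]) auto
qed

lemma L_Delta_iff_of_proportional: "G \<in> L_Delta c \<longleftrightarrow> F \<in> L_Delta c"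
proof -
  have "(\<lambda>x. delta_mass c G (x + y)) \<sim>[at_top] delta_mass c G \<longleftrightarrow>
        (\<lambda>x. delta_mass c F (x + y)) \<sim>[at_top] delta_mass c F" if "0 < y" for y
  proof -
    have "(\<lambda>x. delta_mass c G (x + y)) \<sim>[at_top] delta_mass c G \<longleftrightarrow>
          (\<lambda>x. r * delta_mass c F (x + y)) \<sim>[at_top] (\<lambda>x. r * delta_mass c F x)"
      using that
      by (intro asymp_equiv_cong eventually_mono[OF eventually_ge_at_top[of 0]]
          delta_mass_proportional) auto
    also have "\<dots> \<longleftrightarrow> (\<lambda>x. delta_mass c F (x + y)) \<sim>[at_top] delta_mass c F"
      using less_imp_neq[OF r] by (simp add: asymp_equiv_def cong: if_cong)
    finally show ?thesis .
  qed
  moreover have "(\<forall>x\<ge>x0. 0 < delta_mass c G x) \<longleftrightarrow> (\<forall>x\<ge>x0. 0 < delta_mass c F x)"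
    if "0 < x0" for x0
    using that r by (simp add: delta_mass_proportional zero_less_mult_iff)
  ultimately show ?thesis
    using F G c by (auto simp: L_Delta_def long_tailed_fun_def borel_measurable_delta_mass)
qed

lemma D_Delta_of_proportional:
  assumes "F \<in> D_Delta c"
  shows "G \<in> D_Delta c"
proof -
  from assms obtain x0 K where "x0 > 0" "K > 0"
    "\<And>x y. x > x0 \<Longrightarrow> y > 0 \<Longrightarrow> delta_mass c F (x + y) \<le> K * delta_mass c F x"
    by (auto simp: D_Delta_def almost_decreasing_def)
  then have "\<forall>x>x0. \<forall>y>0. delta_mass c G (x + y) \<le> K * delta_mass c G x"
    using r by (simp add: delta_mass_proportional mult.left_commute[of K r])
  then show ?thesis
    using G \<open>x0 > 0\<close> \<open>K > 0\<close> by (auto simp: D_Delta_def almost_decreasing_def)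
qed

lemma S_Delta_iff_of_proportional:
  assumes "F \<in> D_Delta c"
  shows "G \<in> S_Delta c \<longleftrightarrow> F \<in> S_Delta c"
proof (cases "F \<in> L_Delta c")
  case False
  then show ?thesis using L_Delta_iff_of_proportional by (auto simp: S_Delta_def)
next
  case True
  let ?IF = "\<lambda>x. pos_contribution c F x / delta_mass c F x"
  have GL: "G \<in> L_Delta c" using True L_Delta_iff_of_proportional by simp
  have "\<forall>\<^sub>F x in at_top. pos_contribution c G x / delta_mass c G x = r * ?IF x"
    using eventually_ge_at_top[of 0]
    by eventually_elim
       (use r in \<open>simp add: delta_mass_proportional pos_contribution_proportional power2_eq_square\<close>)
  then have "G \<in> S_Delta c \<longleftrightarrow> ((\<lambda>x. r * ?IF x) \<longlongrightarrow> r * (2 * measure F {0<..})) at_top"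
    unfolding S_Delta_iff_pos_contribution[OF c GL D_Delta_of_proportional[OF assms]]
    using GF[of "{0<..}"] by (simp add: tendsto_cong mult.left_commute)
  also have "\<dots> \<longleftrightarrow> F \<in> S_Delta c"
    unfolding S_Delta_iff_pos_contribution[OF c True assms]
    using tendsto_mult_left_iff[of r ?IF] r by simp
  finally show ?thesis .
qed

end

section \<open>The two nonnegative versions of a distribution\<close>

text \<open>
  An image measure gives \<open>F\<^sup>+\<close> on every Borel set through preimages, where the distribution
  function gives it only on half-lines.
\<close>

lemma pos_part_distr_eq_distr:
  assumes "real_distribution F"
  shows "pos_part_distr F = distr F borel (max 0)"
proof -
  interpret real_distribution F by fact
  have "max 0 -` {..x} = (if 0 \<le> x then {..x} else {})" for x :: real by auto
  then have "cdf (distr F borel (max 0)) = (\<lambda>x. if 0 \<le> x then cdf F x else 0)"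
    by (auto simp: cdf_def measure_distr)
  then show ?thesis
    by (intro cdf_unique)
       (simp_all add: cdf_pos_part_distr real_distribution_pos_part_distr assms real_distribution_distr)
qed

lemma measure_pos_part_distr:
  assumes "real_distribution F" "B \<in> sets borel" "B \<subseteq> {0<..}"
  shows "measure (pos_part_distr F) B = measure F B"
proof -
  interpret real_distribution F by fact
  have "max 0 -` B = B"
    using assms(3) by (auto simp: max_def split: if_splits)
  then show ?thesis
    using assms by (simp add: pos_part_distr_eq_distr measure_distr)
qed

lemma real_distribution_cond_nonneg:
  assumes "real_distribution F" "0 < measure F {0..}"
  shows "real_distribution (cond_nonneg F)"
proof -
  interpret real_distribution F by fact
  have "prob_space (cond_nonneg F)"
    unfolding cond_nonneg_def using assms(2)
    by (intro prob_space_uniform_measure) (auto simp: emeasure_eq_measure)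
  then show ?thesis
    by (simp add: real_distribution_def real_distribution_axioms_def cond_nonneg_def)
qed

lemma measure_cond_nonneg:
  assumes "real_distribution F" "0 < measure F {0..}" "B \<in> sets borel" "B \<subseteq> {0<..}"
  shows "measure (cond_nonneg F) B = inverse (measure F {0..}) * measure F B"
proof -
  interpret real_distribution F by fact
  have "{0..} \<inter> B = B" using assms(4) by auto
  then show ?thesis
    using assms by (simp add: cond_nonneg_def emeasure_eq_measure measure_uniform_measure field_simps)
qed

lemma measure_nonneg_pos_of_S_Delta:
  assumes "F \<in> S_Delta c"
  shows "0 < measure F {0..}"
proof -
  from assms have "real_distribution F" by (simp add: S_Delta_def L_Delta_def)
  then interpret real_distribution F .
  from assms obtain x where "0 < x" "0 < delta_mass c F x"
    by (auto simp: S_Delta_def L_Delta_def long_tailed_fun_def)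
  then have "0 < measure F {x<..x + c}" by (simp add: delta_mass_def)
  also have "\<dots> \<le> measure F {0..}"
    using \<open>0 < x\<close> by (intro finite_measure_mono) auto
  finally show ?thesis .
qed

lemma S_Delta_pos_part_distr_iff:
  assumes "0 < c" "F \<in> D_Delta c"
  shows "pos_part_distr F \<in> S_Delta c \<longleftrightarrow> F \<in> S_Delta c"
proof -
  have F: "real_distribution F" using assms by (simp add: D_Delta_def)
  show ?thesis
    using measure_pos_part_distr[OF F] assms
    by (intro S_Delta_iff_of_proportional[where r=1] F real_distribution_pos_part_distr) auto
qed

lemma S_Delta_cond_nonneg_iff:
  assumes "0 < c" "F \<in> D_Delta c"
  shows "0 < measure F {0..} \<and> cond_nonneg F \<in> S_Delta c \<longleftrightarrow> F \<in> S_Delta c"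
proof -
  have F: "real_distribution F" using assms by (simp add: D_Delta_def)
  have "cond_nonneg F \<in> S_Delta c \<longleftrightarrow> F \<in> S_Delta c" if p: "0 < measure F {0..}"
    using measure_cond_nonneg[OF F p] assms p
    by (intro S_Delta_iff_of_proportional[where r="inverse (measure F {0..})"] F
        real_distribution_cond_nonneg) auto
  then show ?thesis using measure_nonneg_pos_of_S_Delta by blast
qed

theorem proposition2p3:
  fixes F :: "real measure"
  assumes "real_distribution F"
  shows "(\<forall>c>0. F \<in> D_Delta c \<longrightarrow>
            (pos_part_distr F \<in> S_Delta c \<longleftrightarrow>
               0 < measure F {0..} \<and> cond_nonneg F \<in> S_Delta c) \<and>
            (0 < measure F {0..} \<and> cond_nonneg F \<in> S_Delta c \<longleftrightarrow> F \<in> S_Delta c)) \<and>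
         (F \<in> D_loc \<longrightarrow>
            (pos_part_distr F \<in> S_loc \<longleftrightarrow>
               0 < measure F {0..} \<and> cond_nonneg F \<in> S_loc) \<and>
            (0 < measure F {0..} \<and> cond_nonneg F \<in> S_loc \<longleftrightarrow> F \<in> S_loc))"
proof (intro conjI allI impI)
  fix c :: real assume c: "0 < c" "F \<in> D_Delta c"
  note iffs = S_Delta_pos_part_distr_iff[OF c] S_Delta_cond_nonneg_iff[OF c]
  show "pos_part_distr F \<in> S_Delta c \<longleftrightarrow> 0 < measure F {0..} \<and> cond_nonneg F \<in> S_Delta c"
    using iffs by blast
  show "0 < measure F {0..} \<and> cond_nonneg F \<in> S_Delta c \<longleftrightarrow> F \<in> S_Delta c"
    by (fact iffs(2))
next
  assume "F \<in> D_loc"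
  then have D: "F \<in> D_Delta c" if "0 < c" for c using that by (simp add: D_loc_def)
  have pos_part: "pos_part_distr F \<in> S_loc \<longleftrightarrow> F \<in> S_loc"
    using S_Delta_pos_part_distr_iff[OF _ D] by (simp add: S_loc_def)
  \<comment> \<open>The positivity of \<open>F([0,\<infinity>))\<close> stands outside the quantifier over \<open>c\<close>; any single \<open>c\<close>,
    here 1, provides it.\<close>
  have cond: "0 < measure F {0..} \<and> cond_nonneg F \<in> S_loc \<longleftrightarrow> F \<in> S_loc"
    using S_Delta_cond_nonneg_iff[OF _ D] zero_less_one[where 'a=real]
    unfolding S_loc_def mem_Collect_eq by blast
  show "pos_part_distr F \<in> S_loc \<longleftrightarrow> 0 < measure F {0..} \<and> cond_nonneg F \<in> S_loc"
    using pos_part cond by blast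
  show "0 < measure F {0..} \<and> cond_nonneg F \<in> S_loc \<longleftrightarrow> F \<in> S_loc"
    by (fact cond)
qed

end
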